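(* Let $g_4:\{\texttt{0},\texttt{1},\texttt{2}\}^*\to\{\texttt{0},\texttt{1}\}^*$ be the morphism $g_4(\texttt{0})=\texttt{00010011000111011}$, $g_4(\texttt{1})=\texttt{000100111011}$, $g_4(\texttt{2})=\texttt{00111}$. Every bi-infinite binary word whose only square factors are $\texttt{00}$, $\texttt{11}$, $\texttt{001001}$ and $\texttt{110110}$ has the same set of finite factors as $g_4(b_3)$.
   Context: $b_3$ is the Hall–Thue word, the fixed point starting with $\texttt{0}$ of the morphism $\texttt{0}\mapsto\texttt{012}$, $\texttt{1}\mapsto\texttt{02}$, $\texttt{2}\mapsto\texttt{1}$. A square is a nonempty word of the form $uu$. *)

theory Defs
  imports "HOL-Library.Stream"
begin

datatype binary = B0 | B1
datatype ternary = T0 | T1 | T2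

text \<open>
  A non-erasing morphism is given by its letter images \<open>f\<close>. On right-infinite words it acts by
  concatenating the images of the letters; \<^const>\<open>flat\<close> expresses this only if no \<open>f a\<close> is empty.
\<close>

definition morph_inf :: "('a \<Rightarrow> 'b list) \<Rightarrow> 'a stream \<Rightarrow> 'b stream" where
  "morph_inf f s = flat (smap f s)"

fun hall_thue :: "ternary \<Rightarrow> ternary list" where
  "hall_thue T0 = [T0, T1, T2]"
| "hall_thue T1 = [T0, T2]"
| "hall_thue T2 = [T1]"

fun g4 :: "ternary \<Rightarrow> binary list" where
  "g4 T0 = [B0, B0, B0, B1, B0, B0, B1, B1, B0, B0, B0, B1, B1, B1, B0, B1, B1]"
| "g4 T1 = [B0, B0, B0, B1, B0, B0, B1, B1, B1, B0, B1, B1]"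
| "g4 T2 = [B0, B0, B1, B1, B1]"

definition b3 :: "ternary stream" where
  "b3 = (THE s. shd s = T0 \<and> morph_inf hall_thue s = s)"

definition factors_inf :: "'a stream \<Rightarrow> 'a list set" where
  "factors_inf s = {stake n (sdrop i s) | i n. True}"

definition factors_biinf :: "(int \<Rightarrow> 'a) \<Rightarrow> 'a list set" where
  "factors_biinf w = {map w [i..j] | i j. True}"

definition is_square :: "'a list \<Rightarrow> bool" where
  "is_square x \<longleftrightarrow> (\<exists>u. u \<noteq> [] \<and> x = u @ u)"

text \<open>The rest of the theory shows that the description of \<^const>\<open>b3\<close> is proper.\<close>

lemma hall_thue_ne: "hall_thue a \<noteq> []"
  by (cases a) auto

lemma g4_ne: "g4 a \<noteq> []"
  by (cases a) auto

lemma morph_inf_SCons: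
  assumes "f a \<noteq> []"
  shows "morph_inf f (a ## s) = f a @- morph_inf f s"
  using assms by (simp add: morph_inf_def flat_Stream)

lemma morph_inf_shift:
  assumes "\<And>a. f a \<noteq> []"
  shows "morph_inf f (xs @- s) = concat (map f xs) @- morph_inf f s"
  by (induction xs) (simp_all add: morph_inf_SCons assms)

definition ht_iter :: "nat \<Rightarrow> ternary list" where
  "ht_iter n = ((\<lambda>xs. concat (map hall_thue xs)) ^^ n) [T0]"

lemma ht_iter_0: "ht_iter 0 = [T0]"
  by (simp add: ht_iter_def)

lemma ht_iter_Suc: "ht_iter (Suc n) = concat (map hall_thue (ht_iter n))"
  by (simp add: ht_iter_def)

lemma ht_iter_ext: "\<exists>ys. ys \<noteq> [] \<and> ht_iter (Suc n) = ht_iter n @ ys"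
proof (induction n)
  case 0
  show ?case by (simp add: ht_iter_0 ht_iter_Suc)
next
  case (Suc n)
  then obtain ys where ys: "ys \<noteq> []" "ht_iter (Suc n) = ht_iter n @ ys"
    by blast
  have "ht_iter (Suc (Suc n)) = ht_iter (Suc n) @ concat (map hall_thue ys)"
    using ys(2) by (metis concat_append ht_iter_Suc map_append)
  moreover have "concat (map hall_thue ys) \<noteq> []"
    using ys(1) hall_thue_ne by (cases ys) auto
  ultimately show ?case by blast
qed

lemma length_ht_iter: "n < length (ht_iter n)"
proof (induction n)
  case 0
  show ?case by (simp add: ht_iter_0)
next
  case (Suc n)
  obtain ys where "ys \<noteq> []" "ht_iter (Suc n) = ht_iter n @ ys"
    using ht_iter_ext by blast
  with Suc show ?case by (cases ys) auto
qed

lemma ht_iter_nth: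
  assumes "m \<le> n" "k < length (ht_iter m)"
  shows "ht_iter n ! k = ht_iter m ! k \<and> k < length (ht_iter n)"
  using assms
proof (induction n rule: dec_induct)
  case (step n)
  obtain ys where "ht_iter (Suc n) = ht_iter n @ ys"
    using ht_iter_ext by blast
  with step show ?case by (simp add: nth_append)
qed simp

definition ht_limit :: "ternary stream" where
  "ht_limit = smap (\<lambda>n. ht_iter n ! n) nats"

lemma ht_limit_prefix: "stake (length (ht_iter n)) ht_limit = ht_iter n"
proof (rule nth_equalityI)
  fix k assume "k < length (stake (length (ht_iter n)) ht_limit)"
  then have k: "k < length (ht_iter n)" by simp
  have "ht_iter k ! k = ht_iter n ! k"
    using ht_iter_nth[of k n k] ht_iter_nth[of n k k] length_ht_iter[of k] k
    by (cases "k \<le> n") auto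
  with k show "stake (length (ht_iter n)) ht_limit ! k = ht_iter n ! k"
    by (simp add: ht_limit_def)
qed simp

lemma stream_eq_stakeI:
  assumes "\<And>n. \<exists>m\<ge>n. stake m s = stake m t"
  shows "s = t"
proof -
  have "s !! k = t !! k" for k
  proof -
    obtain m where "m \<ge> Suc k" "stake m s = stake m t"
      using assms by blast
    then show ?thesis by (metis Suc_le_lessD stake_nth)
  qed
  then show ?thesis by (metis smap_alt stream.map_ident)
qed

lemma stake_shift_length: "stake (length xs) (xs @- s) = xs"
  by (simp add: stake_shift)

lemma ht_fixed_prefix:
  assumes "shd s = T0" "morph_inf hall_thue s = s"
  shows "\<exists>t. s = ht_iter n @- t"
proof (induction n)
  case 0
  show ?case using assms(1) by (metis ht_iter_0 shift.simps stream.collapse)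
next
  case (Suc n)
  then show ?case
    using assms(2) morph_inf_shift[of hall_thue, OF hall_thue_ne] ht_iter_Suc by metis
qed

lemma b3_ex1: "\<exists>!s. shd s = T0 \<and> morph_inf hall_thue s = s"
proof (rule ex1I)
  have "shd ht_limit = T0"
    by (simp add: ht_limit_def ht_iter_0)
  moreover have "morph_inf hall_thue ht_limit = ht_limit"
  proof (rule stream_eq_stakeI)
    fix n
    let ?m = "length (ht_iter (Suc n))"
    have "ht_limit = ht_iter n @- sdrop (length (ht_iter n)) ht_limit"
      by (metis ht_limit_prefix stake_sdrop)
    then have "morph_inf hall_thue ht_limit =
        ht_iter (Suc n) @- morph_inf hall_thue (sdrop (length (ht_iter n)) ht_limit)"
      using morph_inf_shift[of hall_thue, OF hall_thue_ne] ht_iter_Suc by metis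
    then have "stake ?m (morph_inf hall_thue ht_limit) = stake ?m ht_limit"
      using stake_shift_length ht_limit_prefix by metis
    moreover have "n \<le> ?m" using length_ht_iter[of "Suc n"] by simp
    ultimately show "\<exists>m\<ge>n. stake m (morph_inf hall_thue ht_limit) = stake m ht_limit"
      by blast
  qed
  ultimately show "shd ht_limit = T0 \<and> morph_inf hall_thue ht_limit = ht_limit" ..
next
  fix s assume s: "shd s = T0 \<and> morph_inf hall_thue s = s"
  show "s = ht_limit"
  proof (rule stream_eq_stakeI)
    fix n
    obtain t where "s = ht_iter n @- t"
      using ht_fixed_prefix s by blast
    then have "stake (length (ht_iter n)) s = stake (length (ht_iter n)) ht_limit"
      using stake_shift_length ht_limit_prefix by metis
    moreover have "n \<le> length (ht_iter n)" using length_ht_iter[of n] by simp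
    ultimately show "\<exists>m\<ge>n. stake m s = stake m ht_limit" by blast
  qed
qed

lemma b3_fixed: "shd b3 = T0" "morph_inf hall_thue b3 = b3"
  using theI'[OF b3_ex1] by (simp_all add: b3_def)

end

theory Submission
  imports Defs "HOL-Library.Sublist"
begin

text \<open>
  A finite backtracking search shows that \<open>w\<close> splits into blocks \<open>g4 a\<close>, so \<open>w\<close> is the image of a
  bi-infinite ternary word \<open>t\<close>. This \<open>t\<close> is square-free and avoids 010 and 212, since otherwise its
  image would contain a long square. By Thue's argument such a word is the \<open>hall_thue\<close>-image of
  another word of the same kind, hence for every \<open>n\<close> the \<open>hall_thue\<^sup>n\<close>-image of one. For large \<open>n\<close>,
  a given factor of \<open>t\<close> lies in the image of two distinct adjacent letters, all pairs of which occur
  in \<open>b3\<close>; conversely, a given factor of \<open>b3\<close> lies in the image of 0, and 0 occurs in every such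
  word. So \<open>t\<close> has the factors of \<open>b3\<close>, and \<open>w\<close> those of \<open>g4(b3)\<close>.
\<close>

section \<open>Occurrences in bi-infinite words\<close>

primrec occurs :: "(int \<Rightarrow> 'a) \<Rightarrow> int \<Rightarrow> 'a list \<Rightarrow> bool" where
  "occurs w i [] \<longleftrightarrow> True"
| "occurs w i (a # u) \<longleftrightarrow> w i = a \<and> occurs w (i + 1) u"

lemma occurs_append:
  "occurs w i (u @ v) \<longleftrightarrow> occurs w i u \<and> occurs w (i + int (length u)) v"
  by (induction u arbitrary: i) (auto simp: add.assoc add.commute)

lemma occurs_iff_map_upto: "occurs w i u \<longleftrightarrow> u = map w [i..i + int (length u) - 1]"
proof (induction u arbitrary: i)
  case (Cons a u)
  have "[i..i + int (length (a # u)) - 1] = i # [i + 1..i + 1 + int (length u) - 1]"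
    by (subst upto_rec1) auto
  with Cons[of "i + 1"] show ?case by auto
qed simp

lemma factors_biinf_iff_occurs: "u \<in> factors_biinf w \<longleftrightarrow> (\<exists>i. occurs w i u)"
proof
  assume "u \<in> factors_biinf w"
  then obtain i j where "u = map w [i..j]"
    by (auto simp: factors_biinf_def)
  then have "occurs w i u"
    by (cases "i \<le> j") (simp_all add: occurs_iff_map_upto)
  then show "\<exists>i. occurs w i u" ..
qed (auto simp: factors_biinf_def occurs_iff_map_upto)

lemma occurs_sublist:
  assumes "occurs w i v" "sublist u v"
  shows "\<exists>j. occurs w j u"
  using assms by (auto simp: sublist_def occurs_append)

lemma occurs_covered_sublist:
  assumes "occurs w i v" "occurs w j u" "i \<le> j" "j + int (length u) \<le> i + int (length v)"
  shows "sublist u v"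
proof -
  define k where "k = nat (j - i)"
  have k_bounds: "j = i + int k" "k + length u \<le> length v"
    using assms(3,4) by (auto simp: k_def)
  define y where "y = take (length u) (drop k v)"
  have v_split: "v = take k v @ y @ drop (length u) (drop k v)"
    by (simp add: y_def del: drop_drop)
  have "length (take k v) = k" "length y = length u"
    using k_bounds(2) by (auto simp: y_def)
  moreover have "occurs w (i + int (length (take k v))) y"
    using assms(1) by (subst (asm) v_split) (simp add: occurs_append)
  ultimately have "y = u"
    using assms(2) k_bounds(1) by (metis occurs_iff_map_upto)
  with v_split show ?thesis
    by (metis sublist_appendI)
qed

definition occurs_around :: "(int \<Rightarrow> 'a) \<Rightarrow> int \<Rightarrow> 'a list \<Rightarrow> 'a list \<Rightarrow> bool" where
  "occurs_around w c l r \<longleftrightarrow> occurs w (c - int (length l)) l \<and> occurs w c r"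

lemma occurs_around_shift:
  "occurs_around w c l (u @ r) \<longleftrightarrow> occurs_around w (c + int (length u)) (l @ u) r"
  by (auto simp: occurs_around_def occurs_append)

lemma occurs_around_mono:
  assumes "occurs_around w c l r" "suffix l' l" "prefix r' r"
  shows "occurs_around w c l' r'"
  using assms by (auto simp: occurs_around_def suffix_def prefix_def occurs_append)

lemma occurs_around_append: "occurs_around w c l r \<Longrightarrow> occurs w (c - int (length l)) (l @ r)"
  by (simp add: occurs_around_def occurs_append)

section \<open>Morphisms and factors of right-infinite words\<close>

abbreviation morph :: "('a \<Rightarrow> 'b list) \<Rightarrow> 'a list \<Rightarrow> 'b list" where
  "morph f u \<equiv> concat (map f u)"

lemma morph_morph: "morph f (morph g u) = morph (\<lambda>a. morph f (g a)) u"
  by (induction u) simp_all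

lemma length_le_length_morph:
  assumes "\<And>a. f a \<noteq> []"
  shows "length u \<le> length (morph f u)"
proof (induction u)
  case (Cons a u)
  with assms[of a] show ?case by (cases "f a") auto
qed simp

primrec morph_pow :: "('a \<Rightarrow> 'a list) \<Rightarrow> nat \<Rightarrow> 'a \<Rightarrow> 'a list" where
  "morph_pow h 0 = (\<lambda>a. [a])"
| "morph_pow h (Suc n) = (\<lambda>a. morph (morph_pow h n) (h a))"

lemma factors_inf_iff: "v \<in> factors_inf s \<longleftrightarrow> (\<exists>x t. s = x @- v @- t)"
proof
  assume "v \<in> factors_inf s"
  then obtain i n where "v = stake n (sdrop i s)"
    by (auto simp: factors_inf_def)
  then have "s = stake i s @- v @- sdrop n (sdrop i s)"
    by (metis stake_sdrop)
  then show "\<exists>x t. s = x @- v @- t" by blast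
next
  assume "\<exists>x t. s = x @- v @- t"
  then obtain x t where "s = x @- v @- t" by blast
  then have "v = stake (length v) (sdrop (length x) s)"
    by (simp add: stake_shift sdrop_shift)
  then show "v \<in> factors_inf s"
    by (auto simp: factors_inf_def)
qed

lemma factors_inf_sublist:
  assumes "v \<in> factors_inf s" "sublist u v"
  shows "u \<in> factors_inf s"
proof -
  obtain x t y z where "s = x @- v @- t" "v = y @ u @ z"
    using assms by (auto simp: factors_inf_iff sublist_def)
  then have "s = (x @ y) @- u @- (z @- t)" by simp
  then show ?thesis
    unfolding factors_inf_iff by blast
qed

lemma factors_inf_prefix: "x \<in> factors_inf (x @- t)"
  unfolding factors_inf_iff by (metis shift.simps(1))

lemma factors_inf_sublist_long_prefix:
  assumes "v \<in> factors_inf s"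
  obtains n where "\<And>x t. s = x @- t \<Longrightarrow> n \<le> length x \<Longrightarrow> sublist v x"
proof -
  obtain y t where s_split: "s = (y @ v) @- t"
    using assms by (auto simp: factors_inf_iff)
  have "sublist v x" if x_prefix: "s = x @- t'" "length (y @ v) \<le> length x" for x t'
  proof -
    have "y @ v = stake (length (y @ v)) s"
      unfolding s_split by (rule stake_shift_length[symmetric])
    also have "\<dots> = take (length (y @ v)) x"
      using x_prefix by (simp add: stake_shift)
    finally have "prefix (y @ v) x"
      by (metis take_is_prefix)
    then show ?thesis
      by (auto simp: prefix_def sublist_def)
  qed
  then show ?thesis by (rule that)
qed

lemma factors_inf_morph_inf:
  assumes nonerasing: "\<And>a. f a \<noteq> []"
  shows "factors_inf (morph_inf f s) = {v. \<exists>u \<in> factors_inf s. sublist v (morph f u)}"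
proof (intro set_eqI iffI)
  fix v assume "v \<in> factors_inf (morph_inf f s)"
  then obtain n
    where long_prefix: "\<And>x t. morph_inf f s = x @- t \<Longrightarrow> n \<le> length x \<Longrightarrow> sublist v x"
    by (rule factors_inf_sublist_long_prefix) blast
  have "s = stake n s @- sdrop n s"
    by (simp only: stake_sdrop)
  then have "morph_inf f s = morph f (stake n s) @- morph_inf f (sdrop n s)"
    and "stake n s \<in> factors_inf s"
    using morph_inf_shift[of f, OF nonerasing] factors_inf_prefix by metis+
  moreover have "n \<le> length (morph f (stake n s))"
    using length_le_length_morph[of f "stake n s", OF nonerasing] by simp
  ultimately show "v \<in> {v. \<exists>u \<in> factors_inf s. sublist v (morph f u)}"
    using long_prefix by blast
next
  fix v assume "v \<in> {v. \<exists>u \<in> factors_inf s. sublist v (morph f u)}"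
  then obtain x u t where "s = x @- u @- t" and v_covered: "sublist v (morph f u)"
    by (auto simp: factors_inf_iff)
  then have "morph_inf f s = morph f x @- morph f u @- morph_inf f t"
    by (simp add: morph_inf_shift[OF nonerasing])
  then show "v \<in> factors_inf (morph_inf f s)"
    using v_covered factors_inf_iff factors_inf_sublist by metis
qed

lemma fixed_point_prefix:
  assumes nonerasing: "\<And>a. h a \<noteq> []" and fixed: "morph_inf h s = s" and "s = x @- t"
  shows "\<exists>t'. s = morph (morph_pow h n) x @- t'"
  using assms(3)
proof (induction n arbitrary: x t)
  case 0
  then show ?case by (auto simp: concat_map_singleton)
next
  case (Suc n)
  have "s = morph h x @- morph_inf h t"
    using morph_inf_shift[of h x t, OF nonerasing] fixed Suc.prems by simp
  from Suc.IH[OF this] show ?case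
    by (simp add: morph_morph)
qed

lemma factors_inf_fixed_point:
  assumes nonerasing: "\<And>a. h a \<noteq> []" and fixed: "morph_inf h s = s" and "u \<in> factors_inf s"
  shows "morph (morph_pow h n) u \<in> factors_inf s"
proof -
  obtain x t where "s = (x @ u) @- t"
    using assms(3) by (auto simp: factors_inf_iff)
  from fixed_point_prefix[OF nonerasing fixed this]
  obtain t' where "s = morph (morph_pow h n) x @- morph (morph_pow h n) u @- t'"
    by auto
  then show ?thesis
    unfolding factors_inf_iff by blast
qed

section \<open>Desubstitution\<close>

definition desubst ::
  "('a \<Rightarrow> 'b list) \<Rightarrow> (int \<Rightarrow> 'b) \<Rightarrow> (int \<Rightarrow> 'a) \<Rightarrow> (int \<Rightarrow> int) \<Rightarrow> bool" where
  "desubst f w t p \<longleftrightarrow>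
     (\<forall>i. occurs w (p i) (f (t i)) \<and> p (i + 1) = p i + int (length (f (t i))))"

lemma bi_infinite_path:
  assumes start: "c \<in> C"
    and succ: "\<And>x. x \<in> C \<Longrightarrow> \<exists>y \<in> C. R x y"
    and pred: "\<And>y. y \<in> C \<Longrightarrow> \<exists>x \<in> C. R x y"
  shows "\<exists>z. \<forall>i :: int. R (z i) (z (i + 1))"
proof -
  have "\<exists>f. \<forall>n. (f n \<in> C \<and> (n = 0 \<longrightarrow> f n = c)) \<and> R (f n) (f (Suc n))"
    using start succ by (intro dependent_nat_choice) auto
  then obtain f where forward: "f 0 = c" "R (f n) (f (Suc n))" for n by blast
  have "\<exists>g. \<forall>n. (g n \<in> C \<and> (n = 0 \<longrightarrow> g n = c)) \<and> R (g (Suc n)) (g n)"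
    using start pred by (intro dependent_nat_choice) auto
  then obtain g where backward: "g 0 = c" "R (g (Suc n)) (g n)" for n by blast
  define z where "z i = (if 0 \<le> i then f (nat i) else g (nat (- i)))" for i
  have "R (z i) (z (i + 1))" for i
  proof (cases "0 \<le> i")
    case True
    then have "nat (i + 1) = Suc (nat i)" by simp
    with True forward(2) show ?thesis by (simp add: z_def)
  next
    case False
    then have "z (i + 1) = g (nat (- (i + 1)))" "nat (- i) = Suc (nat (- (i + 1)))"
      using forward(1) backward(1) by (cases "i = -1"; simp add: z_def)+
    with False backward(2) show ?thesis by (simp add: z_def)
  qed
  then show ?thesis by blast
qed

lemma desubst_exists:
  assumes "C \<noteq> {}"
    and next_block: "\<And>c. c \<in> C \<Longrightarrow> \<exists>a. occurs w c (f a) \<and> c + int (length (f a)) \<in> C"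
    and previous_block: "\<And>c. c \<in> C \<Longrightarrow>
      \<exists>a. occurs w (c - int (length (f a))) (f a) \<and> c - int (length (f a)) \<in> C"
  shows "\<exists>t p. desubst f w t p"
proof -
  define block where "block c d \<longleftrightarrow> (\<exists>a. occurs w c (f a) \<and> d = c + int (length (f a)))" for c d
  obtain c where "c \<in> C" using assms(1) by blast
  moreover have "\<exists>d \<in> C. block c d" if "c \<in> C" for c
    using next_block[OF that] by (auto simp: block_def)
  moreover have "\<exists>c \<in> C. block c d" if "d \<in> C" for d
    using previous_block[OF that] by (force simp: block_def)
  ultimately obtain p where "\<forall>i :: int. block (p i) (p (i + 1))"
    using bi_infinite_path[of c C block] by blast
  then obtain t where "\<forall>i. occurs w (p i) (f (t i)) \<and> p (i + 1) = p i + int (length (f (t i)))"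
    unfolding block_def by metis
  then show ?thesis
    unfolding desubst_def by blast
qed

lemma desubst_occurs:
  assumes "desubst f w t p" "occurs t i u"
  shows "occurs w (p i) (morph f u) \<and> p (i + int (length u)) = p i + int (length (morph f u))"
  using assms(2)
proof (induction u arbitrary: i)
  case (Cons a u)
  then have "t i = a" "occurs t (i + 1) u" by auto
  moreover have "p (i + 1) = p i + int (length (f (t i)))" "occurs w (p i) (f (t i))"
    using assms(1) by (auto simp: desubst_def)
  ultimately show ?case
    using Cons.IH[of "i + 1"] by (simp add: occurs_append add.assoc)
qed simp

lemma desubst_id: "desubst (\<lambda>a. [a]) w w (\<lambda>i. i)"
  by (simp add: desubst_def)

lemma desubst_compose:
  assumes "desubst f w t p" "desubst g t s q"
  shows "desubst (\<lambda>a. morph f (g a)) w s (\<lambda>i. p (q i))"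
proof -
  have "occurs t (q i) (g (s i))" "q (i + 1) = q i + int (length (g (s i)))" for i
    using assms(2) by (auto simp: desubst_def)
  with desubst_occurs[OF assms(1)] show ?thesis
    by (auto simp: desubst_def)
qed

lemma strict_mono_int_interval:
  fixes p :: "int \<Rightarrow> int"
  assumes "\<And>i. p i < p (i + 1)"
  shows "\<exists>i. p i \<le> j \<and> j < p (i + 1)"
proof (induction j rule: int_induct[where k = "p 0"])
  case base
  show ?case using assms[of 0] by auto
next
  case (step1 j)
  then obtain i where "p i \<le> j" "j < p (i + 1)" by blast
  with assms[of "i + 1"] show ?case
    by (cases "j + 1 < p (i + 1)") (force intro: exI[of _ "i + 1"])+
next
  case (step2 j)
  then obtain i where "p i \<le> j" "j < p (i + 1)" by blast
  with assms[of "i - 1"] show ?case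
    by (cases "p i \<le> j - 1") (force intro: exI[of _ "i - 1"])+
qed

lemma desubst_cover:
  assumes image: "desubst f w t p" and nonerasing: "\<And>a. f a \<noteq> []" and occurrence: "occurs w j v"
    and long_image: "\<And>u. length u = n \<Longrightarrow> length v \<le> length (morph f u)"
  shows "\<exists>i u. length u = Suc n \<and> occurs t i u \<and> sublist v (morph f u)"
proof -
  have next_p: "p (i + 1) = p i + int (length (f (t i)))" for i
    using image by (simp add: desubst_def)
  have "p i < p (i + 1)" for i
    using nonerasing[of "t i"] by (simp add: next_p)
  then obtain i where first_block: "p i \<le> j" "j < p (i + 1)"
    using strict_mono_int_interval by blast
  define u where "u = map t [i + 1..i + int n]"
  have u_tail: "length u = n" "occurs t (i + 1) u"
    by (simp_all add: u_def occurs_iff_map_upto)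
  then have "occurs w (p i) (morph f (t i # u))"
    using desubst_occurs[OF image, of i "t i # u"] by simp
  moreover have "j + int (length v) \<le> p i + int (length (morph f (t i # u)))"
    using first_block(2) long_image[OF u_tail(1)] by (simp add: next_p)
  ultimately have "sublist v (morph f (t i # u))"
    using occurs_covered_sublist[OF _ occurrence first_block(1)] by blast
  with u_tail show ?thesis
    by (intro exI[of _ i] exI[of _ "t i # u"]) simp
qed

lemma factors_biinf_desubst:
  assumes image: "desubst f w t p" and nonerasing: "\<And>a. f a \<noteq> []"
  shows "factors_biinf w = {v. \<exists>u \<in> factors_biinf t. sublist v (morph f u)}"
proof (intro set_eqI iffI)
  fix v assume "v \<in> factors_biinf w"
  then obtain j where occurrence: "occurs w j v"
    by (auto simp: factors_biinf_iff_occurs)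
  have "length v \<le> length (morph f u)" if "length u = length v" for u
    using length_le_length_morph[of f u, OF nonerasing] that by simp
  with desubst_cover[OF image nonerasing occurrence, of "length v"]
  obtain i u where "occurs t i u" "sublist v (morph f u)" by blast
  then show "v \<in> {v. \<exists>u \<in> factors_biinf t. sublist v (morph f u)}"
    by (auto simp: Bex_def factors_biinf_iff_occurs)
next
  fix v assume "v \<in> {v. \<exists>u \<in> factors_biinf t. sublist v (morph f u)}"
  then obtain i u where "occurs t i u" "sublist v (morph f u)"
    by (auto simp: factors_biinf_iff_occurs)
  with desubst_occurs[OF image] occurs_sublist show "v \<in> factors_biinf w"
    unfolding factors_biinf_iff_occurs by blast
qed

section \<open>Self-similar bi-infinite words\<close>

locale self_similar =
  fixes h :: "'a \<Rightarrow> 'a list" and s :: "'a stream" and W :: "(int \<Rightarrow> 'a) \<Rightarrow> bool"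
  assumes nonerasing: "h a \<noteq> []"
    and fixed: "morph_inf h s = s"
    and growing: "n \<le> length (morph_pow h n a)"
    and desubst_step: "W t \<Longrightarrow> \<exists>t' p. desubst h t t' p \<and> W t'"
    and adjacent_letters: "W t \<Longrightarrow> [t i, t (i + 1)] \<in> factors_inf s"
    and first_letter: "W t \<Longrightarrow> \<exists>i. t i = shd s"
begin

lemma desubst_pow:
  assumes "W t"
  shows "\<exists>t' p. desubst (morph_pow h n) t t' p \<and> W t'"
proof (induction n)
  case 0
  show ?case using desubst_id assms by auto
next
  case (Suc n)
  then obtain t' p where image: "desubst (morph_pow h n) t t' p" "W t'" by blast
  obtain t'' q where "desubst h t' t'' q" "W t''"
    using desubst_step[OF image(2)] by blast
  with desubst_compose[OF image(1)] show ?case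
    unfolding morph_pow.simps by blast
qed

lemma factors_biinf_subset:
  assumes "W t"
  shows "factors_biinf t \<subseteq> factors_inf s"
proof
  fix v assume "v \<in> factors_biinf t"
  then obtain j where occurrence: "occurs t j v"
    by (auto simp: factors_biinf_iff_occurs)
  define f where "f = morph_pow h (Suc (length v))"
  obtain t' p where image: "desubst f t t' p" "W t'"
    unfolding f_def using desubst_pow[OF assms] by blast
  have long: "length v < length (f a)" for a
    using growing[of "Suc (length v)" a] by (simp add: f_def)
  then have f_nonerasing: "f a \<noteq> []" for a
    by (metis list.size(3) not_less_zero)
  have "length v \<le> length (morph f u)" if "length u = 1" for u
    using that long[of "hd u"] by (cases u) auto
  with desubst_cover[OF image(1) f_nonerasing occurrence, of 1]
  obtain i u where two_blocks: "length u = Suc 1" "occurs t' i u" "sublist v (morph f u)"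
    by blast
  from two_blocks(1,2) have "u = [t' i, t' (i + 1)]"
    by (auto simp: length_Suc_conv)
  then have "morph f u \<in> factors_inf s"
    unfolding f_def
    using factors_inf_fixed_point[OF nonerasing fixed] adjacent_letters[OF image(2)] by blast
  with two_blocks(3) show "v \<in> factors_inf s"
    using factors_inf_sublist by blast
qed

lemma factors_inf_subset:
  assumes "W t"
  shows "factors_inf s \<subseteq> factors_biinf t"
proof
  fix v assume "v \<in> factors_inf s"
  then obtain n where long_prefix: "\<And>x r. s = x @- r \<Longrightarrow> n \<le> length x \<Longrightarrow> sublist v x"
    by (rule factors_inf_sublist_long_prefix) blast
  have "s = [shd s] @- stl s" by simp
  from fixed_point_prefix[OF nonerasing fixed this]
  obtain r where "s = morph_pow h n (shd s) @- r" by auto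
  with long_prefix growing have v_covered: "sublist v (morph_pow h n (shd s))" by blast
  obtain t' p where image: "desubst (morph_pow h n) t t' p" "W t'"
    using desubst_pow[OF assms] by blast
  obtain i where "t' i = shd s"
    using first_letter[OF image(2)] by blast
  with image(1) have "occurs t (p i) (morph_pow h n (shd s))"
    unfolding desubst_def by metis
  with v_covered show "v \<in> factors_biinf t"
    using occurs_sublist factors_biinf_iff_occurs by metis
qed

lemma factors_eq: "W t \<Longrightarrow> factors_biinf t = factors_inf s"
  using factors_biinf_subset factors_inf_subset by blast

end

section \<open>Squares\<close>

definition squares_within :: "'a list set \<Rightarrow> (int \<Rightarrow> 'a) \<Rightarrow> bool" where
  "squares_within R w \<longleftrightarrow> (\<forall>i u. u \<noteq> [] \<longrightarrow> occurs w i (u @ u) \<longrightarrow> u \<in> R)"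

abbreviation square_free :: "(int \<Rightarrow> 'a) \<Rightarrow> bool" where
  "square_free \<equiv> squares_within {}"

lemma squares_within_iff_factors:
  "squares_within R w \<longleftrightarrow> (\<forall>x \<in> factors_biinf w. is_square x \<longrightarrow> x \<in> (\<lambda>u. u @ u) ` R)"
proof -
  have "u @ u = v @ v \<longleftrightarrow> u = v" for u v :: "'a list"
    by (auto simp: append_eq_append_conv_if dest: arg_cong[of _ _ length])
  then show ?thesis
    by (auto simp: squares_within_def factors_biinf_iff_occurs is_square_def)
qed

lemma squares_withinD:
  assumes "squares_within R w" "occurs w i x" "sublist (u @ u) x" "u \<noteq> []"
  shows "u \<in> R"
  using assms occurs_sublist unfolding squares_within_def by blast

lemma desubst_not_occurs:
  assumes "desubst f w t p" "squares_within R w"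
    and "sublist (u @ u) (morph f x)" "u \<noteq> []" "u \<notin> R"
  shows "\<not> occurs t i x"
  using assms desubst_occurs squares_withinD by metis

lemma square_free_desubst:
  assumes image: "desubst f w t p" and nonerasing: "\<And>a. f a \<noteq> []"
    and squares: "squares_within R w" and short: "\<And>u a. u \<in> R \<Longrightarrow> length u < length (f a)"
  shows "square_free t"
proof -
  have "\<not> occurs t i (u @ u)" if u_nonempty: "u \<noteq> []" for i u
  proof (rule desubst_not_occurs[OF image squares])
    have "length (f (hd u)) \<le> length (morph f u)" using u_nonempty by (cases u) auto
    with short show "morph f u \<notin> R" by (metis not_le)
    show "morph f u \<noteq> []" using u_nonempty nonerasing by (cases u) auto
  qed simp
  then show ?thesis
    by (auto simp: squares_within_def)
qed

lemma square_free_adjacent: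
  assumes "square_free t"
  shows "t i \<noteq> t (i + 1)"
  using squares_withinD[OF assms, of i "[t i, t i]" "[t i]"] by auto

lemma square_free_alternating:
  assumes "square_free t" "t i = t (i + 2)"
  shows "t (i + 1) \<noteq> t (i + 3)"
  using assms squares_withinD[of "{}" t i "[t i, t (i + 1), t i, t (i + 1)]" "[t i, t (i + 1)]"]
  by (auto simp: add.assoc)

section \<open>Square-free ternary words avoiding 010 and 212\<close>

lemma ternary_third_letter:
  fixes a b c d :: ternary
  assumes "a \<noteq> b" "c \<noteq> a" "c \<noteq> b" "d \<noteq> a" "d \<noteq> b"
  shows "c = d"
  using assms by (cases a; cases b; cases c; cases d) simp_all

lemma square_free_letter:
  fixes t :: "int \<Rightarrow> ternary"
  assumes square_free: "square_free t"
  shows "\<exists>i. t i = a"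
proof (rule ccontr)
  assume "\<nexists>i. t i = a"
  then have no_a: "t i \<noteq> a" for i by blast
  have "t i = t (i + 2)" for i
  proof -
    have "t i \<noteq> t (i + 1)" "t (i + 1) \<noteq> t (i + 2)"
      using square_free_adjacent[OF square_free, of i]
        square_free_adjacent[OF square_free, of "i + 1"]
      by (simp_all add: add.assoc)
    then show ?thesis
      using ternary_third_letter[of a "t (i + 1)" "t i" "t (i + 2)"] no_a by metis
  qed
  from this[of 0] this[of 1] square_free_alternating[OF square_free, of 0] show False by simp
qed

lemma square_free_extend_aba:
  fixes t :: "int \<Rightarrow> ternary"
  assumes square_free: "square_free t" and aba: "occurs t i [a, b, a]"
    and third_letter: "c \<noteq> a" "c \<noteq> b"
  shows "occurs t (i - 1) [c, a, b, a, c]"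
proof -
  have letters: "t i = a" "t (i + 1) = b" "t (i + 2) = a"
    using aba by (auto simp: add.assoc)
  have "a \<noteq> b" "t (i - 1) \<noteq> a" "t (i + 3) \<noteq> a"
    using square_free_adjacent[OF square_free, of i]
      square_free_adjacent[OF square_free, of "i - 1"]
      square_free_adjacent[OF square_free, of "i + 2"] letters by (auto simp: add.assoc)
  moreover have "t (i - 1) \<noteq> b" "t (i + 3) \<noteq> b"
    using square_free_alternating[OF square_free, of i]
      square_free_alternating[OF square_free, of "i - 1"] letters
    by (auto simp: algebra_simps)
  ultimately have "t (i - 1) = c" "t (i + 3) = c"
    using third_letter ternary_third_letter[of a b _ c] by blast+
  with letters show ?thesis by (simp add: add.assoc)
qed

definition thue_word :: "(int \<Rightarrow> ternary) \<Rightarrow> bool" where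
  "thue_word t \<longleftrightarrow> square_free t \<and>
     (\<forall>i. \<not> occurs t i [T0, T1, T0] \<and> \<not> occurs t i [T2, T1, T2])"

text \<open>
  If \<open>f(1) = zy\<close> where \<open>z\<close> is a prefix and \<open>y\<close> a suffix of \<open>f(0)\<close>, the images of 010 and 02120
  contain the squares of \<open>yz\<close> and \<open>yf(2)z\<close>. In a square-free word, 212 extends to 02120.
\<close>

lemma thue_word_desubst:
  assumes image: "desubst f w t p" and nonerasing: "\<And>a. f a \<noteq> []"
    and squares: "squares_within R w" and short: "\<And>u a. u \<in> R \<Longrightarrow> length u < length (f a)"
    and f_T1_T0: "f T1 = z @ y" "prefix z (f T0)" "suffix y (f T0)"
  shows "thue_word t"
proof -
  have square_free: "square_free t"
    using square_free_desubst[OF image nonerasing squares short] .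
  obtain x x' where f_T0: "f T0 = z @ x" "f T0 = x' @ y"
    using f_T1_T0(2,3) by (auto simp: prefix_def suffix_def)
  have notin_R: "u \<notin> R" if "length (f a) \<le> length u" for u a
    using short[of u a] that by auto
  have "\<not> occurs t i [T0, T1, T0]" for i
  proof (rule desubst_not_occurs[OF image squares])
    have "morph f [T0, T1, T0] = f T0 @ f T1 @ f T0" by simp
    also have "\<dots> = (x' @ y) @ (z @ y) @ (z @ x)"
      by (simp only: f_T1_T0(1) flip: f_T0)
    finally show "sublist ((y @ z) @ (y @ z)) (morph f [T0, T1, T0])"
      by (metis append.assoc sublist_appendI)
    show "y @ z \<noteq> []" using nonerasing[of T1] f_T1_T0(1) by auto
    show "y @ z \<notin> R" using notin_R[of T1 "y @ z"] f_T1_T0(1) by simp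
  qed
  moreover have "\<not> occurs t i [T0, T2, T1, T2, T0]" for i
  proof (rule desubst_not_occurs[OF image squares])
    let ?u = "y @ f T2 @ z"
    have "morph f [T0, T2, T1, T2, T0] = f T0 @ f T2 @ f T1 @ f T2 @ f T0" by simp
    also have "\<dots> = (x' @ y) @ f T2 @ (z @ y) @ f T2 @ (z @ x)"
      by (simp only: f_T1_T0(1) flip: f_T0)
    finally show "sublist (?u @ ?u) (morph f [T0, T2, T1, T2, T0])"
      by (metis append.assoc sublist_appendI)
    show "?u \<noteq> []" using nonerasing[of T2] by simp
    show "?u \<notin> R" using notin_R[of T2 ?u] by simp
  qed
  then have "\<not> occurs t i [T2, T1, T2]" for i
    using square_free_extend_aba[OF square_free] by blast
  ultimately show ?thesis
    using square_free by (simp add: thue_word_def)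
qed

lemma thue_word_adjacent: "thue_word t \<Longrightarrow> t i \<noteq> t (i + 1)"
  using square_free_adjacent by (auto simp: thue_word_def)

lemma thue_word_neighbours_of_T1:
  assumes thue: "thue_word t" and middle: "t i = T1"
  shows "t (i - 1) = T0 \<and> t (i + 1) = T2 \<or> t (i - 1) = T2 \<and> t (i + 1) = T0"
proof -
  have "t (i - 1) \<noteq> T1" "t (i + 1) \<noteq> T1"
    using thue_word_adjacent[OF thue, of "i - 1"] thue_word_adjacent[OF thue, of i] middle by auto
  moreover have "\<not> occurs t (i - 1) [T0, T1, T0]" "\<not> occurs t (i - 1) [T2, T1, T2]"
    using thue unfolding thue_word_def by blast+
  ultimately show ?thesis
    using middle by (cases "t (i - 1)"; cases "t (i + 1)") auto
qed

definition hall_thue_cuts :: "(int \<Rightarrow> ternary) \<Rightarrow> int set" where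
  "hall_thue_cuts t = {c. t c = T0 \<or> t (c - 1) = T2}"

lemma hall_thue_cuts_next:
  assumes thue: "thue_word t" and cut: "c \<in> hall_thue_cuts t"
  shows "\<exists>a. occurs t c (hall_thue a) \<and> c + int (length (hall_thue a)) \<in> hall_thue_cuts t"
proof (cases "t c")
  case T0
  show ?thesis
  proof (cases "t (c + 1)")
    case T1
    with T0 have "t (c + 2) = T2"
      using thue_word_neighbours_of_T1[OF thue, of "c + 1"] by (simp add: add.assoc)
    with T0 T1 show ?thesis
      by (intro exI[of _ T0]) (simp add: hall_thue_cuts_def algebra_simps)
  next
    case T2
    with T0 show ?thesis
      by (intro exI[of _ T1]) (simp add: hall_thue_cuts_def algebra_simps)
  qed (use T0 thue_word_adjacent[OF thue, of c] in simp)
next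
  case T1
  with cut have "t (c + 1) = T0"
    using thue_word_neighbours_of_T1[OF thue, of c] by (auto simp: hall_thue_cuts_def)
  with T1 show ?thesis
    by (intro exI[of _ T2]) (simp add: hall_thue_cuts_def)
next
  case T2
  with cut thue_word_adjacent[OF thue, of "c - 1"] show ?thesis
    by (simp add: hall_thue_cuts_def)
qed

lemma hall_thue_cuts_previous:
  assumes thue: "thue_word t" and cut: "c \<in> hall_thue_cuts t"
  shows "\<exists>a. occurs t (c - int (length (hall_thue a))) (hall_thue a) \<and>
    c - int (length (hall_thue a)) \<in> hall_thue_cuts t"
proof (cases "t (c - 1)")
  case T0
  with cut thue_word_adjacent[OF thue, of "c - 1"] show ?thesis
    by (simp add: hall_thue_cuts_def)
next
  case T1
  with cut have "t (c - 2) = T2"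
    using thue_word_neighbours_of_T1[OF thue, of "c - 1"] by (auto simp: hall_thue_cuts_def)
  with T1 show ?thesis
    by (intro exI[of _ T2]) (simp add: hall_thue_cuts_def)
next
  case T2
  show ?thesis
  proof (cases "t (c - 2)")
    case T0
    with T2 show ?thesis
      by (intro exI[of _ T1]) (simp add: hall_thue_cuts_def)
  next
    case T1
    with T2 have "t (c - 3) = T0"
      using thue_word_neighbours_of_T1[OF thue, of "c - 2"] by auto
    with T1 T2 show ?thesis
      by (intro exI[of _ T0]) (simp add: hall_thue_cuts_def)
  qed (use T2 thue_word_adjacent[OF thue, of "c - 2"] in simp)
qed

lemma thue_word_desubst_hall_thue:
  assumes thue: "thue_word t"
  shows "\<exists>s p. desubst hall_thue t s p \<and> thue_word s"
proof -
  have square_free: "square_free t"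
    using thue by (simp add: thue_word_def)
  then have "hall_thue_cuts t \<noteq> {}"
    using square_free_letter[of t T0] by (auto simp: hall_thue_cuts_def)
  then obtain s p where image: "desubst hall_thue t s p"
    using desubst_exists hall_thue_cuts_next[OF thue] hall_thue_cuts_previous[OF thue] by metis
  have "thue_word s"
    by (rule thue_word_desubst[OF image hall_thue_ne square_free, of "[T0]" "[T2]"])
      (simp_all add: suffix_def)
  with image show ?thesis by blast
qed

lemma b3_adjacent_letters:
  assumes "a \<noteq> b"
  shows "[a, b] \<in> factors_inf b3"
proof (rule factors_inf_sublist)
  show "ht_iter 3 \<in> factors_inf b3"
    using ht_fixed_prefix[OF b3_fixed] factors_inf_prefix by metis
  have "ht_iter 3 = [T0, T1, T2, T0, T2, T1, T0, T1, T2, T1, T0, T2]"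
    by (simp add: ht_iter_0 ht_iter_Suc numeral_3_eq_3)
  with assms show "sublist [a, b] (ht_iter 3)"
    by (cases a; cases b) (simp_all add: sublist_Cons_right)
qed

lemma length_morph_pow_hall_thue:
  "n + 1 \<le> length (morph_pow hall_thue n T0)" "n + 1 \<le> length (morph_pow hall_thue n T1)"
  "max 1 n \<le> length (morph_pow hall_thue n T2)"
  by (induction n) simp_all

interpretation thue: self_similar hall_thue b3 thue_word
proof
  show "n \<le> length (morph_pow hall_thue n a)" for n a
    using length_morph_pow_hall_thue[of n] by (cases a) auto
  show "[t i, t (i + 1)] \<in> factors_inf b3" if "thue_word t" for t i
    using thue_word_adjacent[OF that] by (rule b3_adjacent_letters)
  show "\<exists>i. t i = shd b3" if "thue_word t" for t
    using that square_free_letter by (simp add: thue_word_def)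
qed (use hall_thue_ne b3_fixed thue_word_desubst_hall_thue in blast)+

section \<open>Backtracking over factors\<close>

text \<open>
  Search over the factors \<open>l @ r\<close> around a fixed position (between \<open>l\<close> and \<open>r\<close>): the word is
  extended by up to \<open>m\<close> letters of the alphabet \<open>A\<close> to the left, then by up to \<open>n\<close> to the right,
  and a branch is closed as soon as the target \<open>P\<close> is reached or \<open>Q\<close> rejects the factor.
\<close>

fun unavoidable :: "'a list \<Rightarrow> ('a list \<Rightarrow> bool) \<Rightarrow> ('a list \<Rightarrow> 'a list \<Rightarrow> bool) \<Rightarrow>
    nat \<Rightarrow> nat \<Rightarrow> 'a list \<Rightarrow> 'a list \<Rightarrow> bool" where
  "unavoidable A Q P (Suc m) n l r \<longleftrightarrow> P l r \<or> Q (l @ r) \<or>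
     list_all (\<lambda>a. unavoidable A Q P m n (a # l) r) A"
| "unavoidable A Q P 0 (Suc n) l r \<longleftrightarrow> P l r \<or> Q (l @ r) \<or>
     list_all (\<lambda>a. unavoidable A Q P 0 n l (r @ [a])) A"
| "unavoidable A Q P 0 0 l r \<longleftrightarrow> P l r \<or> Q (l @ r)"

lemma occurs_around_extend_left:
  "occurs_around w c l r \<Longrightarrow> occurs_around w c (w (c - int (length l) - 1) # l) r"
  by (simp add: occurs_around_def algebra_simps)

lemma occurs_around_extend_right:
  "occurs_around w c l r \<Longrightarrow> occurs_around w c l (r @ [w (c + int (length r))])"
  by (simp add: occurs_around_def occurs_append)

lemma unavoidable_sound:
  assumes "\<And>i. w i \<in> set A" "\<And>i x. occurs w i x \<Longrightarrow> \<not> Q x"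
    and "unavoidable A Q P m n l r" "occurs_around w c l r"
  shows "\<exists>l r. P l r \<and> occurs_around w c l r"
  using assms
proof (induction A Q P m n l r rule: unavoidable.induct[case_names left right stop])
  case (left A Q P m n l r)
  note alphabet = left.prems(1) and avoids = left.prems(2) and around = left.prems(4)
  consider (found) "P l r" | (extend) "unavoidable A Q P m n (w (c - int (length l) - 1) # l) r"
    using left.prems(3) alphabet avoids[OF occurs_around_append[OF around]]
    by (auto simp: list_all_iff)
  then show ?case
  proof cases
    case extend
    with left.IH[OF alphabet alphabet] avoids occurs_around_extend_left[OF around]
    show ?thesis by blast
  qed (use around in blast)
next
  case (right A Q P n l r)
  note alphabet = right.prems(1) and avoids = right.prems(2) and around = right.prems(4)
  consider (found) "P l r" | (extend) "unavoidable A Q P 0 n l (r @ [w (c + int (length r))])"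
    using right.prems(3) alphabet avoids[OF occurs_around_append[OF around]]
    by (auto simp: list_all_iff)
  then show ?case
  proof cases
    case extend
    with right.IH[OF alphabet alphabet] avoids occurs_around_extend_right[OF around]
    show ?thesis by blast
  qed (use around in blast)
next
  case (stop A Q P l r)
  then show ?case
    using occurs_around_append by fastforce
qed

definition forbidden_square_at :: "'a list set \<Rightarrow> nat \<Rightarrow> nat \<Rightarrow> 'a list \<Rightarrow> bool" where
  "forbidden_square_at R p i x \<longleftrightarrow>
     (let u = take p (drop i x) in u = take p (drop (i + p) x) \<and> u \<noteq> [] \<and> u \<notin> R)"

text \<open>
  If \<open>2 * p\<close> exceeds the length of \<open>x\<close>, the truncated subtraction yields position 0, which is tested
  anyway.
\<close>

definition forbidden_square_at_end :: "'a list set \<Rightarrow> nat \<Rightarrow> 'a list \<Rightarrow> bool" where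
  "forbidden_square_at_end R k x \<longleftrightarrow>
     list_ex (\<lambda>p. forbidden_square_at R p 0 x \<or> forbidden_square_at R p (length x - 2 * p) x)
       [1..<k]"

lemma forbidden_square_atD:
  assumes "forbidden_square_at R p i x"
  shows "\<exists>u. sublist (u @ u) x \<and> u \<noteq> [] \<and> u \<notin> R"
proof -
  obtain u where square: "u = take p (drop i x)" "u = take p (drop p (drop i x))" "u \<noteq> []" "u \<notin> R"
    using assms unfolding forbidden_square_at_def Let_def drop_drop by (metis add.commute)
  then have "x = take i x @ (u @ u) @ drop p (drop p (drop i x))"
    by (metis append_take_drop_id append.assoc)
  with square(3,4) show ?thesis
    by (metis sublist_appendI)
qed

lemma squares_within_no_forbidden_square_at_end:
  assumes "squares_within R w" "occurs w i x"
  shows "\<not> forbidden_square_at_end R k x"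
  using assms forbidden_square_atD squares_withinD
  unfolding forbidden_square_at_end_def list_ex_iff by metis

section \<open>Binary words with four squares\<close>

definition square_roots :: "binary list set" where
  "square_roots = {[B0], [B1], [B0, B0, B1], [B1, B1, B0]}"

text \<open>Squares of period at most 9 turn out to suffice for closing all branches below.\<close>

abbreviation forced ::
  "(binary list \<Rightarrow> binary list \<Rightarrow> bool) \<Rightarrow> nat \<Rightarrow> nat \<Rightarrow> binary list \<Rightarrow> binary list \<Rightarrow> bool"
where
  "forced \<equiv> unavoidable [B0, B1] (forbidden_square_at_end square_roots 10)"

lemma forced_sound:
  assumes "squares_within square_roots w" "forced P m n l r" "occurs_around w c l r"
  shows "\<exists>l r. P l r \<and> occurs_around w c l r"
proof (rule unavoidable_sound[OF _ _ assms(2,3)])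
  show "w i \<in> set [B0, B1]" for i
    by (cases "w i") simp_all
  show "\<not> forbidden_square_at_end square_roots 10 x" if "occurs w i x" for i x
    using squares_within_no_forbidden_square_at_end[OF assms(1) that] .
qed

text \<open>
  The boundaries between \<open>g4\<close>-blocks are the positions followed by 00 and preceded by one of these
  words: the only other occurrences of 11 followed by 00, inside \<open>g4 T0\<close>, are preceded by 0.
\<close>

definition cut_words :: "binary list list" where
  "cut_words = [[B1, B0, B1, B1], [B1, B1, B1]]"

definition g4_cuts :: "(int \<Rightarrow> binary) \<Rightarrow> int set" where
  "g4_cuts w = {c. \<exists>s \<in> set cut_words. occurs_around w c s [B0, B0]}"

definition ends_after_cut :: "binary list \<Rightarrow> binary list \<Rightarrow> bool" where
  "ends_after_cut l r \<longleftrightarrow> list_ex (\<lambda>s. suffix (s @ [B0, B0]) r) cut_words"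

definition followed_by_block :: "binary list \<Rightarrow> binary list \<Rightarrow> bool" where
  "followed_by_block l r \<longleftrightarrow> list_ex (\<lambda>a. prefix (g4 a @ [B0, B0]) r) [T0, T1, T2]"

definition preceded_by_block :: "binary list \<Rightarrow> binary list \<Rightarrow> bool" where
  "preceded_by_block l r \<longleftrightarrow>
     list_ex (\<lambda>a. list_ex (\<lambda>s. suffix (s @ g4 a) l) cut_words) [T0, T1, T2]"

lemma forced_cut: "forced ends_after_cut 0 22 [] []"
  by code_simp

lemma forced_next_block: "list_all (\<lambda>s. forced followed_by_block 4 20 s [B0, B0]) cut_words"
  by code_simp

lemma forced_previous_block: "list_all (\<lambda>s. forced preceded_by_block 17 8 s [B0, B0]) cut_words"
  by code_simp

lemma g4_cuts_nonempty:
  assumes squares: "squares_within square_roots w"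
  shows "g4_cuts w \<noteq> {}"
proof -
  have "occurs_around w 0 [] []"
    by (simp add: occurs_around_def)
  from forced_sound[OF squares forced_cut this]
  obtain l r s where cut_word: "s \<in> set cut_words" "suffix (s @ [B0, B0]) r" "occurs_around w 0 l r"
    by (auto simp: ends_after_cut_def list_ex_iff)
  then obtain x where "r = (x @ s) @ [B0, B0]"
    by (auto simp: suffix_def)
  with cut_word(3) have "occurs_around w (int (length (x @ s))) (l @ x @ s) [B0, B0]"
    using occurs_around_shift[of w 0 l "x @ s"] by simp
  then have "occurs_around w (int (length (x @ s))) s [B0, B0]"
    by (rule occurs_around_mono) (simp_all add: suffix_def)
  with cut_word(1) show ?thesis
    by (auto simp: g4_cuts_def)
qed

lemma g4_ends_in_cut_word: "\<exists>s \<in> set cut_words. suffix s (g4 a)"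
  by (cases a) (simp_all add: cut_words_def suffix_def)

lemma g4_cuts_next:
  assumes squares: "squares_within square_roots w" and "c \<in> g4_cuts w"
  shows "\<exists>a. occurs w c (g4 a) \<and> c + int (length (g4 a)) \<in> g4_cuts w"
proof -
  obtain s where cut_word: "s \<in> set cut_words" "occurs_around w c s [B0, B0]"
    using assms(2) by (auto simp: g4_cuts_def)
  then have "forced followed_by_block 4 20 s [B0, B0]"
    using forced_next_block by (simp only: list_all_iff)
  from forced_sound[OF squares this cut_word(2)]
  obtain l r a where "prefix (g4 a @ [B0, B0]) r" "occurs_around w c l r"
    by (auto simp: followed_by_block_def list_ex_iff simp del: g4.simps)
  then have "occurs_around w c [] (g4 a @ [B0, B0])"
    by (auto intro: occurs_around_mono)
  then have "occurs w c (g4 a)"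
    and next_cut: "occurs_around w (c + int (length (g4 a))) (g4 a) [B0, B0]"
    using occurs_around_shift[of w c "[]" "g4 a"]
    by (simp_all add: occurs_around_def occurs_append del: g4.simps)
  moreover obtain s' where "s' \<in> set cut_words" "suffix s' (g4 a)"
    using g4_ends_in_cut_word by blast
  ultimately show ?thesis
    unfolding g4_cuts_def using occurs_around_mono[OF next_cut] by blast
qed

lemma g4_cuts_previous:
  assumes squares: "squares_within square_roots w" and "c \<in> g4_cuts w"
  shows "\<exists>a. occurs w (c - int (length (g4 a))) (g4 a) \<and> c - int (length (g4 a)) \<in> g4_cuts w"
proof -
  obtain s where cut_word: "s \<in> set cut_words" "occurs_around w c s [B0, B0]"
    using assms(2) by (auto simp: g4_cuts_def)
  then have "forced preceded_by_block 17 8 s [B0, B0]"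
    using forced_previous_block by (simp only: list_all_iff)
  from forced_sound[OF squares this cut_word(2)]
  obtain l r a s' where block: "suffix (s' @ g4 a) l" "occurs_around w c l r"
    and previous_cut_word: "s' \<in> set cut_words"
    unfolding preceded_by_block_def list_ex_iff by blast
  define d where "d = c - int (length (g4 a))"
  have "occurs_around w (d + int (length (g4 a))) (s' @ g4 a) []"
    using occurs_around_mono[OF block(2,1)] by (simp add: d_def)
  then have "occurs_around w d s' (g4 a)"
    using occurs_around_shift[of w d s' "g4 a" "[]"] by simp
  moreover have "prefix [B0, B0] (g4 a)"
    by (cases a) simp_all
  ultimately have "occurs w d (g4 a)" "d \<in> g4_cuts w"
    using previous_cut_word occurs_around_mono unfolding g4_cuts_def occurs_around_def by blast+
  then show ?thesis
    by (auto simp: d_def)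
qed

lemma squares_within_desubst_g4:
  assumes squares: "squares_within square_roots w"
  shows "\<exists>t p. desubst g4 w t p \<and> thue_word t"
proof -
  obtain t p where g4_image: "desubst g4 w t p"
    using desubst_exists g4_cuts_nonempty g4_cuts_next g4_cuts_previous squares by metis
  have "length u < length (g4 a)" if "u \<in> square_roots" for u a
    using that by (cases a) (auto simp: square_roots_def)
  moreover have "g4 T1 = [B0, B0, B0, B1] @ [B0, B0, B1, B1, B1, B0, B1, B1]"
    by simp
  ultimately have "thue_word t"
    by (rule thue_word_desubst[OF g4_image g4_ne squares]) (simp_all add: suffix_def)
  with g4_image show ?thesis by blast
qed

theorem theorem2:
  fixes w :: "int \<Rightarrow> binary"
  assumes "\<And>x. x \<in> factors_biinf w \<Longrightarrow> is_square x \<Longrightarrow>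
    x \<in> {[B0, B0], [B1, B1], [B0, B0, B1, B0, B0, B1], [B1, B1, B0, B1, B1, B0]}"
  shows "factors_biinf w = factors_inf (morph_inf g4 b3)"
proof -
  have "squares_within square_roots w"
    using assms by (simp add: squares_within_iff_factors square_roots_def)
  then obtain t p where g4_image: "desubst g4 w t p" and "thue_word t"
    using squares_within_desubst_g4 by blast
  then have t_factors: "factors_biinf t = factors_inf b3"
    using thue.factors_eq by blast
  have "factors_biinf w = {v. \<exists>u \<in> factors_biinf t. sublist v (morph g4 u)}"
    using factors_biinf_desubst[OF g4_image g4_ne] .
  also have "\<dots> = factors_inf (morph_inf g4 b3)"
    unfolding t_factors factors_inf_morph_inf[OF g4_ne] ..
  finally show ?thesis .
qed

end
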